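(* Let $X$ be an $E$-separated $E$-semigroup. Then: (1) $E(X)$ is a semilattice. (2) For any idempotent $e\in E(X)$ the maximal subgroup $H_e\subseteq X$ is an ideal in the semigroup ${\Uparrow}e$. (3) For any $e\in E(X)$ and $x\in{\Uparrow}e$ we have $ex=xe\in H_e$. (4) For any idempotents $x,y\in E(X)$, the inequality $x\lesssim y$ in $X$ is equivalent to the inequality $x\le y$ in $E(X)$. (5) The map $\pi_{\Updownarrow}:{\Updownarrow}E(X)\to E(X)$ assigning to each element $x\in{\Updownarrow}E(X)$ the unique idempotent in the semigroup ${\Updownarrow}x$ is a well-defined homomorphic retraction of the semigroup ${\Updownarrow}E(X)$ onto $E(X)$. (6) The map $\hbar_{\Updownarrow}:{\Updownarrow}E(X)\to H(X)$, $\hbar_{\Updownarrow}:x\mapsto x\,\pi_{\Updownarrow}(x)$, is a well-defined homomorphic retraction of the semigroup ${\Updownarrow}E(X)$ onto the Clifford part $H(X)$ of $X$. (7) The Clifford part $H(X)$ is a subsemigroup of $X$.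
   Context: For a semigroup $X$, $E(X)=\{x\in X:xx=x\}$ is the set of idempotents. $X$ is an $E$-semigroup if $E(X)$ is a subsemigroup of $X$. A semilattice is a commutative semigroup of idempotents; it carries the natural partial order $x\le y\iff xy=y x=x$. $X$ is $E$-separated if for any distinct $x,y\in E(X)$ there is a homomorphism $h:X\to Y$ to a semilattice $Y$ with $h(x)\ne h(y)$. $X^1=X\cup\{1\}$, where $1$ is an element with $1x=x=x1$ for all $x\in X^1$. For $e\in E(X)$, $H_e=\{x\in X: xX^1=eX^1\text{ and }X^1x=X^1e\}$ is the $\mathcal H$-class of $e$, which is the maximal subgroup of $X$ containing $e$. The Clifford part of $X$ is $H(X)=\bigcup_{e\in E(X)}H_e$. Let $\mathbf 2=\{0,1\}$ with the usual multiplication and the order $0\le1$. For $x,y\in X$ write $x\lesssim y$ if $\chi(x)\le\chi(y)$ for every homomorphism $\chi:X\to\mathbf 2$. Put ${\Uparrow}a=\{x\in X:a\lesssim x\}$ and ${\Updownarrow}a=\{x\in X: a\lesssim x\lesssim a\}$ (both are subsemigroups of $X$), and ${\Updownarrow}E(X)=\bigcup_{e\in E(X)}{\Updownarrow}e$. An ideal of a semigroup $S$ is a subset $I\subseteq S$ with $IS\cup SI\subseteq I$. A homomorphic retraction of a semigroup $S$ onto a subset $T\subseteq S$ is a map $r:S\to T$ with $r(xy)=r(x)r(y)$ for all $x,y\in S$ and $r(t)=t$ for all $t\in T$. *)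

theory Defs
  imports Main
begin

text \<open>
  The ambient semigroup \<open>X\<close> is a type \<open>'a\<close> of class \<open>semigroup_mult\<close>; its subsemigroups are
  subsets of that type.
\<close>

definition subsemigroup :: "'a::semigroup_mult set \<Rightarrow> bool" where
  "subsemigroup S \<longleftrightarrow> (\<forall>x\<in>S. \<forall>y\<in>S. x * y \<in> S)"

definition idems :: "'a::semigroup_mult set" where
  "idems = {x. x * x = x}"

definition E_semigroup :: "'a::semigroup_mult itself \<Rightarrow> bool" where
  "E_semigroup _ \<longleftrightarrow> subsemigroup (idems :: 'a set)"

definition semilattice_on :: "'b set \<Rightarrow> ('b \<Rightarrow> 'b \<Rightarrow> 'b) \<Rightarrow> bool" where
  "semilattice_on Y m \<longleftrightarrow>
     (\<forall>x\<in>Y. \<forall>y\<in>Y. m x y \<in> Y) \<and>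
     (\<forall>x\<in>Y. \<forall>y\<in>Y. \<forall>z\<in>Y. m (m x y) z = m x (m y z)) \<and>
     (\<forall>x\<in>Y. \<forall>y\<in>Y. m x y = m y x) \<and>
     (\<forall>x\<in>Y. m x x = x)"

definition nat_le :: "'a::semigroup_mult \<Rightarrow> 'a \<Rightarrow> bool" where
  "nat_le x y \<longleftrightarrow> x * y = x \<and> y * x = x"

text \<open>
  HOL cannot quantify existentially over types, so the type \<open>'b\<close> in which the target semilattices
  \<open>Y\<close> live is a parameter; \<open>Y\<close> itself is an arbitrary subset of \<open>'b\<close> with an arbitrary
  operation, and may depend on the pair to be separated. Theorems should leave \<open>'b\<close> free in this
  hypothesis. The choice of \<open>'b\<close> does not matter as soon as it is large enough, and \<open>'a\<close> is
  always large enough: see \<open>E_separated_self\<close>.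
\<close>

definition E_separated :: "'a::semigroup_mult itself \<Rightarrow> 'b itself \<Rightarrow> bool" where
  "E_separated _ _ \<longleftrightarrow>
     (\<forall>x\<in>idems. \<forall>y\<in>idems. x \<noteq> y \<longrightarrow>
        (\<exists>(Y :: 'b set) m (h :: 'a \<Rightarrow> 'b).
            semilattice_on Y m \<and> (\<forall>u. h u \<in> Y) \<and>
            (\<forall>u v. h (u * v) = m (h u) (h v)) \<and> h x \<noteq> h y))"

lemma E_separated_self:
  assumes "E_separated TYPE('a::semigroup_mult) TYPE('b)"
  shows "E_separated TYPE('a) TYPE('a)"
  unfolding E_separated_def
proof (intro ballI impI)
  fix x y :: 'a
  assume "x \<in> idems" "y \<in> idems" "x \<noteq> y"
  then obtain Y m and h :: "'a \<Rightarrow> 'b" where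
    Y: "semilattice_on Y m" and hY: "\<And>u. h u \<in> Y"
    and hom: "\<And>u v. h (u * v) = m (h u) (h v)" and ne: "h x \<noteq> h y"
    using assms unfolding E_separated_def by metis
  define s where "s = inv h"
  have hs: "h (s (h u)) = h u" for u
    unfolding s_def by (simp add: f_inv_into_f)
  define k where "k u = s (h u)" for u
  define n where "n u v = k (u * v)" for u v
  have hk: "h (k u) = h u" for u by (simp add: k_def hs)
  have kk: "k u = k v" if "h u = h v" for u v using that by (simp add: k_def)
  have hn: "h (n u v) = m (h u) (h v)" for u v by (simp add: n_def hk hom)
  have "semilattice_on (range k) n"
    unfolding semilattice_on_def
  proof (intro conjI ballI)
    fix u v w :: 'a assume u: "u \<in> range k" and v: "v \<in> range k" and w: "w \<in> range k"
    show "n u v \<in> range k" by (simp add: n_def)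
    show "n (n u v) w = n u (n v w)"
    proof -
      have "m (m (h u) (h v)) (h w) = m (h u) (m (h v) (h w))"
        using Y hY unfolding semilattice_on_def by blast
      then have "h (n u v * w) = h (u * n v w)"
        by (simp add: hom hn)
      then show ?thesis unfolding n_def[of "n u v"] n_def[of u "n v w"] by (rule kk)
    qed
    show "n u v = n v u"
      unfolding n_def by (rule kk) (use Y hY in \<open>simp add: hom semilattice_on_def\<close>)
    show "n u u = u"
    proof -
      from u obtain t where t: "u = k t" by blast
      have "h (u * u) = h t" using Y hY by (simp add: hom t hk semilattice_on_def)
      then have "k (u * u) = k t" by (rule kk)
      then show ?thesis by (simp add: n_def t)
    qed
  qed
  moreover have "k (u * v) = n (k u) (k v)" for u v
    unfolding n_def by (rule kk) (simp add: hom hk)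
  moreover have "k x \<noteq> k y" using ne hk by metis
  ultimately show "\<exists>(Y :: 'a set) m (h :: 'a \<Rightarrow> 'a).
      semilattice_on Y m \<and> (\<forall>u. h u \<in> Y) \<and> (\<forall>u v. h (u * v) = m (h u) (h v)) \<and> h x \<noteq> h y"
    by (intro exI[of _ "range k"] exI[of _ n] exI[of _ k]) auto
qed

text \<open>The principal one-sided ideals \<open>x X\<^sup>1\<close> and \<open>X\<^sup>1 x\<close>; the adjoined \<open>1\<close> contributes \<open>x\<close>.\<close>

definition right_principal :: "'a::semigroup_mult \<Rightarrow> 'a set" where
  "right_principal x = insert x {x * u | u. True}"

definition left_principal :: "'a::semigroup_mult \<Rightarrow> 'a set" where
  "left_principal x = insert x {u * x | u. True}"

definition H_class :: "'a::semigroup_mult \<Rightarrow> 'a set" where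
  "H_class e = {x. right_principal x = right_principal e \<and> left_principal x = left_principal e}"

definition clifford_part :: "'a::semigroup_mult set" where
  "clifford_part = (\<Union>e\<in>idems. H_class e)"

text \<open>Homomorphisms to \<open>{0,1}\<close> with the usual multiplication and order, here those of \<open>nat\<close>.\<close>

definition hom_two :: "('a::semigroup_mult \<Rightarrow> nat) set" where
  "hom_two = {\<chi>. (\<forall>x. \<chi> x \<in> {0, 1}) \<and> (\<forall>x y. \<chi> (x * y) = \<chi> x * \<chi> y)}"

definition lesssim :: "'a::semigroup_mult \<Rightarrow> 'a \<Rightarrow> bool"  (infix "\<lesssim>" 50) where
  "x \<lesssim> y \<longleftrightarrow> (\<forall>\<chi>\<in>hom_two. \<chi> x \<le> \<chi> y)"

definition Up :: "'a::semigroup_mult \<Rightarrow> 'a set" where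
  "Up a = {x. a \<lesssim> x}"

definition UpDown :: "'a::semigroup_mult \<Rightarrow> 'a set" where
  "UpDown a = {x. a \<lesssim> x \<and> x \<lesssim> a}"

definition UpDownE :: "'a::semigroup_mult set" where
  "UpDownE = (\<Union>e\<in>idems. UpDown e)"

definition semigroup_ideal :: "'a::semigroup_mult set \<Rightarrow> 'a set \<Rightarrow> bool" where
  "semigroup_ideal I S \<longleftrightarrow>
     subsemigroup S \<and> I \<subseteq> S \<and> (\<forall>i\<in>I. \<forall>s\<in>S. i * s \<in> I \<and> s * i \<in> I)"

text \<open>Surjectivity onto \<open>T\<close> is implied by the last clause.\<close>

definition hom_retraction ::
  "('a::semigroup_mult \<Rightarrow> 'a) \<Rightarrow> 'a set \<Rightarrow> 'a set \<Rightarrow> bool" where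
  "hom_retraction r S T \<longleftrightarrow>
     subsemigroup S \<and> T \<subseteq> S \<and> (\<forall>x\<in>S. r x \<in> T) \<and>
     (\<forall>x\<in>S. \<forall>y\<in>S. r (x * y) = r x * r y) \<and> (\<forall>t\<in>T. r t = t)"

text \<open>
  The next two functions are meaningful only on \<open>UpDownE\<close>, where existence and uniqueness of the
  idempotent have to be proved.
\<close>

definition pi_UpDown :: "'a::semigroup_mult \<Rightarrow> 'a" where
  "pi_UpDown x = (THE e. e \<in> idems \<and> e \<in> UpDown x)"

definition hbar_UpDown :: "'a::semigroup_mult \<Rightarrow> 'a" where
  "hbar_UpDown x = x * pi_UpDown x"

end

theory Submission
  imports Defs
begin

text \<open>
  Homomorphisms to semilattices cannot tell \<open>a * b\<close> from \<open>b * a\<close>. In an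
  \<open>E\<close>-separated semigroup two such products therefore coincide as soon as both are idempotent
  (\<open>E_separated_swap\<close>), and every use of the separation hypothesis below is an instance of
  this swap property. For two idempotents of an
  \<open>E\<close>-semigroup it says that they commute.

  The heart of the matter is the following observation about an idempotent \<open>e\<close>. If
  \<open>e = p * x * q\<close>, where \<open>e * p = p\<close> and \<open>q * e = q\<close> without loss of generality, then the
  cyclic rearrangements \<open>x * (q * p)\<close> and \<open>(q * p) * x\<close> are idempotent as well, so
  the swap property makes both equal to \<open>e\<close>. Hence \<open>x\<close> has the two-sided inverse
  \<open>q * p\<close> relative to \<open>e\<close> (\<open>local_inverse_of_factor\<close>), which forces \<open>x\<close> to commute
  with \<open>e\<close> and puts \<open>e * x\<close> into the group \<open>H_class e\<close>.

  It follows that the divisors of \<open>e\<close>, that is, the \<open>x\<close> with \<open>e \<in> X x X\<close>, are closed under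
  products; as factors of divisors are divisors, their characteristic function is a homomorphism
  to \<open>{0,1}\<close>. So \<open>Up e\<close> consists of divisors of \<open>e\<close> (\<open>Up_imp_local_inverse\<close>), and statements
  about all homomorphisms to \<open>{0,1}\<close> become equations with relative inverses. Everything else is
  calculation: \<open>H_class e\<close> is the set of all \<open>x \<in> Up e\<close> with \<open>e * x = x\<close>, and the
  multiplicativity of \<open>hbar_UpDown\<close> holds because \<open>e * f\<close> is
  central in \<open>Up (e * f)\<close>, which contains \<open>Up e \<union> Up f\<close>.
\<close>

lemma E_separated_swap:
  fixes a b :: "'a::semigroup_mult"
  assumes sep: "E_separated TYPE('a) TYPE('b)"
    and ab: "a * b \<in> idems" and ba: "b * a \<in> idems"
  shows "a * b = b * a"
proof (rule ccontr)
  assume "a * b \<noteq> b * a"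
  then obtain Y m and h :: "'a \<Rightarrow> 'b" where
    Y: "semilattice_on Y m" and hY: "\<And>u. h u \<in> Y"
    and hom: "\<And>u v. h (u * v) = m (h u) (h v)" and ne: "h (a * b) \<noteq> h (b * a)"
    using sep ab ba unfolding E_separated_def by metis
  from Y hY have "m (h a) (h b) = m (h b) (h a)"
    by (simp add: semilattice_on_def)
  with ne show False by (simp add: hom)
qed

section \<open>The preorder given by homomorphisms to the two-element semilattice\<close>

lemma hom_two_mult_le:
  assumes "\<chi> \<in> hom_two"
  shows "\<chi> (x * y) \<le> \<chi> x" and "\<chi> (x * y) \<le> \<chi> y"
proof -
  have hom: "\<chi> (x * y) = \<chi> x * \<chi> y" and "\<chi> x \<in> {0, 1}" "\<chi> y \<in> {0, 1}"
    using assms by (simp_all add: hom_two_def)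
  then show "\<chi> (x * y) \<le> \<chi> x" and "\<chi> (x * y) \<le> \<chi> y" by auto
qed

lemma lesssim_refl: "x \<lesssim> x"
  by (simp add: lesssim_def)

lemma lesssim_trans: "x \<lesssim> y \<Longrightarrow> y \<lesssim> z \<Longrightarrow> x \<lesssim> z"
  unfolding lesssim_def by (meson order_trans)

lemma mult_lesssim_left: "x * y \<lesssim> x"
  and mult_lesssim_right: "x * y \<lesssim> y"
  using hom_two_mult_le by (auto simp: lesssim_def)

lemma lesssim_mult_mono:
  assumes "x \<lesssim> x'" and "y \<lesssim> y'"
  shows "x * y \<lesssim> x' * y'"
  using assms by (simp add: lesssim_def hom_two_def mult_le_mono)

lemma UpDown_iff: "x \<in> UpDown a \<longleftrightarrow> a \<lesssim> x \<and> x \<lesssim> a"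
  by (simp add: UpDown_def)

lemma UpDown_sym: "x \<in> UpDown a \<longleftrightarrow> a \<in> UpDown x"
  by (auto simp: UpDown_iff)

lemma UpDown_mult: "x \<in> UpDown a \<Longrightarrow> y \<in> UpDown b \<Longrightarrow> x * y \<in> UpDown (a * b)"
  by (simp add: UpDown_iff lesssim_mult_mono)

section \<open>Inverses relative to an idempotent\<close>

text \<open>
  The element \<open>s\<close> inverts \<open>x\<close> up to the idempotent \<open>e\<close>, while \<open>x\<close> itself may lie outside the
  local monoid \<open>e X e\<close>; there, \<open>s\<close> is the inverse of \<open>e * x\<close>.
\<close>

definition local_inverse :: "'a::semigroup_mult \<Rightarrow> 'a \<Rightarrow> 'a \<Rightarrow> bool" where
  "local_inverse e x s \<longleftrightarrow> x * s = e \<and> s * x = e \<and> e * s = s \<and> s * e = s"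

lemma local_inverse_commute:
  assumes "local_inverse e x s"
  shows "e * x = x * e"
proof -
  have "(x * s) * x = x * (s * x)" by (rule mult.assoc)
  then show ?thesis using assms by (simp add: local_inverse_def)
qed

lemma local_inverse_mult:
  assumes x: "local_inverse e x s" and y: "local_inverse e y t"
  shows "local_inverse e (x * y) (t * s)"
proof -
  have "(x * y) * (t * s) = x * ((y * t) * s)" by (simp add: mult.assoc)
  moreover have "(t * s) * (x * y) = t * ((s * x) * y)" by (simp add: mult.assoc)
  moreover have "t * (e * y) = (t * e) * y" by (simp add: mult.assoc)
  moreover have "e * (t * s) = (e * t) * s" by (simp add: mult.assoc)
  moreover have "(t * s) * e = t * (s * e)" by (simp add: mult.assoc)
  ultimately show ?thesis using x y by (simp add: local_inverse_def)
qed

lemma local_inverse_imp_H_class: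
  assumes e: "e \<in> idems" and inv: "local_inverse e x s"
  shows "e * x \<in> H_class e"
proof -
  have comm: "e * x = x * e" using inv by (rule local_inverse_commute)
  have r: "(e * x) * s = e" and l: "s * (e * x) = e"
    using e inv by (simp_all add: local_inverse_def idems_def mult.assoc)
      (simp add: mult.assoc[symmetric])
  have "right_principal (e * x) = right_principal e"
  proof (intro equalityI subsetI)
    fix z assume "z \<in> right_principal (e * x)"
    then show "z \<in> right_principal e" by (auto simp: right_principal_def mult.assoc)
  next
    fix z assume "z \<in> right_principal e"
    then consider "z = (e * x) * s" | u where "z = (e * x) * (s * u)"
      using r by (auto simp: right_principal_def mult.assoc[symmetric])
    then show "z \<in> right_principal (e * x)" by cases (auto simp: right_principal_def)
  qed
  moreover have "left_principal (e * x) = left_principal e"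
  proof (intro equalityI subsetI)
    fix z assume "z \<in> left_principal (e * x)"
    then show "z \<in> left_principal e"
      by (auto simp: left_principal_def comm mult.assoc[symmetric])
  next
    fix z assume "z \<in> left_principal e"
    then consider "z = s * (e * x)" | u where "z = (u * s) * (e * x)"
      using l by (auto simp: left_principal_def mult.assoc)
    then show "z \<in> left_principal (e * x)" by cases (auto simp: left_principal_def)
  qed
  ultimately show ?thesis by (simp add: H_class_def)
qed

lemma H_class_fixed:
  assumes e: "e \<in> idems" and x: "x \<in> H_class e"
  shows "e * x = x" and "x * e = x"
proof -
  have ee: "e * e = e" using e by (simp add: idems_def)
  have "x \<in> right_principal e" "x \<in> left_principal e"
    using x by (auto simp: H_class_def right_principal_def left_principal_def)
  then have "x = e \<or> (\<exists>u. x = e * u)" "x = e \<or> (\<exists>u. x = u * e)"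
    by (auto simp: right_principal_def left_principal_def)
  then show "e * x = x" and "x * e = x"
    by (metis ee mult.assoc)+
qed

lemma H_class_lesssim:
  assumes e: "e \<in> idems" and x: "x \<in> H_class e"
  shows "x \<in> UpDown e"
proof -
  have "e \<in> right_principal x"
    using x by (auto simp: H_class_def right_principal_def)
  then have "e \<lesssim> x"
    by (auto simp: right_principal_def lesssim_refl mult_lesssim_left)
  moreover have "x \<lesssim> e"
    using H_class_fixed(1)[OF e x] mult_lesssim_left[of e x] by simp
  ultimately show ?thesis by (simp add: UpDown_iff)
qed

section \<open>Consequences of the swap property\<close>

context
  assumes swap: "\<And>a b :: 'a::semigroup_mult.
    a * b \<in> idems \<Longrightarrow> b * a \<in> idems \<Longrightarrow> a * b = b * a"
begin

text \<open>
  Padding \<open>p\<close> and \<open>q\<close> with \<open>e\<close> makes the cyclic rearrangements of \<open>p * x * q\<close> idempotent,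
  and each of them is a swap of \<open>p * x * q\<close> itself.
\<close>

lemma local_inverse_of_factor:
  fixes e x p q :: 'a
  assumes e: "e \<in> idems" and pxq: "p * x * q = e"
  shows "\<exists>s. local_inverse e x s"
proof -
  have ee: "e * e = e" using e by (simp add: idems_def)
  define p' q' where "p' = e * p" and "q' = q * e"
  have ep: "e * p' = p'" by (simp add: p'_def ee mult.assoc[symmetric])
  have qe: "q' * e = q'" by (simp add: q'_def ee mult.assoc)
  have "p' * (x * q') = e * (p * x * q) * e" by (simp add: p'_def q'_def mult.assoc)
  then have e_eq: "p' * (x * q') = e" by (simp add: pxq ee)
  then have e_eq': "(p' * x) * q' = e" by (simp add: mult.assoc)
  have "(x * q') * p' * ((x * q') * p') = (x * q') * ((p' * (x * q')) * p')"
    by (simp add: mult.assoc)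
  then have "(x * q') * p' \<in> idems" by (simp add: e_eq ep idems_def)
  then have r: "(x * q') * p' = e" using swap[of p' "x * q'"] e e_eq by simp
  have "q' * (p' * x) * (q' * (p' * x)) = (q' * ((p' * x) * q')) * (p' * x)"
    by (simp add: mult.assoc)
  then have "q' * (p' * x) \<in> idems" by (simp add: e_eq' qe idems_def)
  then have l: "q' * (p' * x) = e" using swap[of "p' * x" q'] e e_eq' by simp
  have "(q' * p') * e = q' * ((p' * (x * q')) * p')"
    by (simp add: r[symmetric] mult.assoc)
  then have se: "(q' * p') * e = q' * p'" by (simp add: e_eq ep)
  have "e * (q' * p') = (q' * ((p' * x) * q')) * p'"
    by (simp add: l[symmetric] mult.assoc)
  then have es: "e * (q' * p') = q' * p'" by (simp add: e_eq' qe)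
  have "local_inverse e x (q' * p')"
    using l r se es by (simp add: local_inverse_def mult.assoc)
  then show ?thesis ..
qed

text \<open>
  The elements with an inverse relative to \<open>e\<close> are closed under products, and a factor of such
  an element is again a factor of \<open>e\<close>. So their characteristic function is one of the
  homomorphisms that define \<open>Up e\<close>.
\<close>

lemma Up_imp_local_inverse:
  fixes e x :: 'a
  assumes e: "e \<in> idems" and x: "x \<in> Up e"
  obtains s where "local_inverse e x s"
proof -
  define F where "F = {x. \<exists>s. local_inverse e x s}"
  have factors: "u \<in> F \<and> v \<in> F" if uv: "u * v \<in> F" for u v
  proof -
    from uv obtain s where "local_inverse e (u * v) s" by (auto simp: F_def)
    then have "s * u * v = e" and "u * v * s = e"
      by (simp_all add: local_inverse_def mult.assoc)
    moreover from this have "(s * u) * v * e = e"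
      using e by (simp add: idems_def)
    ultimately show ?thesis
      unfolding F_def using local_inverse_of_factor[OF e] by blast
  qed
  have "u * v \<in> F \<longleftrightarrow> u \<in> F \<and> v \<in> F" for u v
    using factors[of u v] local_inverse_mult[of e] unfolding F_def by blast
  then have "(\<lambda>u. if u \<in> F then 1 else 0) \<in> hom_two"
    by (simp add: hom_two_def)
  moreover have "e \<in> F"
    using e by (auto simp: F_def local_inverse_def idems_def)
  ultimately have "x \<in> F"
    using x by (fastforce simp: Up_def lesssim_def split: if_splits)
  then show thesis using that by (auto simp: F_def)
qed

lemma Up_commute:
  fixes e x :: 'a
  assumes "e \<in> idems" and "x \<in> Up e"
  shows "e * x = x * e"
  using assms by (meson Up_imp_local_inverse local_inverse_commute)

lemma Up_mult_in_H_class: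
  fixes e x :: 'a
  assumes "e \<in> idems" and "x \<in> Up e"
  shows "e * x \<in> H_class e"
  using assms by (meson Up_imp_local_inverse local_inverse_imp_H_class)

lemma subsemigroup_Up:
  fixes e :: 'a
  assumes "e \<in> idems"
  shows "subsemigroup (Up e)"
  using assms lesssim_mult_mono[of e _ e]
  by (auto simp: subsemigroup_def Up_def idems_def)

lemma H_class_ideal:
  fixes e :: 'a
  assumes e: "e \<in> idems"
  shows "semigroup_ideal (H_class e) (Up e)"
proof -
  have sub: "H_class e \<subseteq> Up e"
    using H_class_lesssim[OF e] by (auto simp: Up_def UpDown_iff)
  have "i * s \<in> H_class e \<and> s * i \<in> H_class e" if i: "i \<in> H_class e" and s: "s \<in> Up e" for i s
  proof -
    have Up: "i * s \<in> Up e" "s * i \<in> Up e"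
      using subsemigroup_Up[OF e] sub i s by (auto simp: subsemigroup_def)
    have "e * (i * s) = i * s"
      by (simp add: H_class_fixed(1)[OF e i] mult.assoc[symmetric])
    moreover have "e * (s * i) = s * (e * i)"
      by (simp add: Up_commute[OF e s] mult.assoc[symmetric])
    then have "e * (s * i) = s * i" by (simp add: H_class_fixed(1)[OF e i])
    ultimately show ?thesis using Up_mult_in_H_class[OF e] Up by metis
  qed
  with sub subsemigroup_Up[OF e] show ?thesis by (auto simp: semigroup_ideal_def)
qed

lemma lesssim_idems_iff_nat_le:
  fixes x y :: 'a
  assumes x: "x \<in> idems" and y: "y \<in> idems"
  shows "x \<lesssim> y \<longleftrightarrow> nat_le x y"
proof
  assume "x \<lesssim> y"
  then obtain s where s: "local_inverse x y s"
    using Up_imp_local_inverse[OF x] by (auto simp: Up_def)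
  \<comment> \<open>An idempotent that has an inverse relative to \<open>x\<close> acts on \<open>x = y * s\<close> as an identity.\<close>
  have "y * (y * s) = y * s" using y by (simp add: idems_def mult.assoc[symmetric])
  then have "y * x = x" using s by (simp add: local_inverse_def)
  then show "nat_le x y"
    using local_inverse_commute[OF s] by (simp add: nat_le_def)
next
  assume "nat_le x y"
  then have "x * y = x" by (simp add: nat_le_def)
  then show "x \<lesssim> y" using mult_lesssim_right[of x y] by simp
qed

lemma UpDown_idem_unique:
  fixes e f x :: 'a
  assumes e: "e \<in> idems" "e \<in> UpDown x" and f: "f \<in> idems" "f \<in> UpDown x"
  shows "e = f"
proof -
  have "e \<lesssim> f" using e f by (auto simp: UpDown_iff intro: lesssim_trans)
  then have "nat_le e f" using lesssim_idems_iff_nat_le e f by blast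
  moreover have "f \<lesssim> e" using e f by (auto simp: UpDown_iff intro: lesssim_trans)
  then have "nat_le f e" using lesssim_idems_iff_nat_le e f by blast
  ultimately show ?thesis by (simp add: nat_le_def)
qed

lemma pi_UpDown_eqI:
  fixes e x :: 'a
  assumes "e \<in> idems" "e \<in> UpDown x"
  shows "pi_UpDown x = e"
  unfolding pi_UpDown_def using assms UpDown_idem_unique by blast

lemma UpDownE_pi_UpDown:
  fixes x :: 'a
  assumes "x \<in> UpDownE"
  shows "pi_UpDown x \<in> idems" and "pi_UpDown x \<in> UpDown x"
proof -
  from assms obtain e where "e \<in> idems" "e \<in> UpDown x"
    unfolding UpDownE_def using UpDown_sym by blast
  with pi_UpDown_eqI show "pi_UpDown x \<in> idems" "pi_UpDown x \<in> UpDown x" by auto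
qed

lemma pi_UpDown_H_class:
  fixes e x :: 'a
  assumes "e \<in> idems" and "x \<in> H_class e"
  shows "pi_UpDown x = e"
  using assms H_class_lesssim UpDown_sym pi_UpDown_eqI by blast

lemma clifford_part_subset_UpDownE: "(clifford_part :: 'a set) \<subseteq> UpDownE"
  using H_class_lesssim by (auto simp: clifford_part_def UpDownE_def)

section \<open>Retractions onto the idempotents and onto the Clifford part\<close>

context
  assumes idems_closed: "subsemigroup (idems :: 'a set)"
begin

lemma semilattice_idems: "semilattice_on (idems :: 'a set) (*)"
  using idems_closed swap
  by (simp add: semilattice_on_def subsemigroup_def mult.assoc) (simp add: idems_def)

lemma subsemigroup_UpDownE: "subsemigroup (UpDownE :: 'a set)"
  unfolding subsemigroup_def
proof (intro ballI)
  fix x y :: 'a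
  assume "x \<in> UpDownE" "y \<in> UpDownE"
  then obtain e f where "e \<in> idems" "f \<in> idems" "x \<in> UpDown e" "y \<in> UpDown f"
    by (auto simp: UpDownE_def)
  then have "e * f \<in> idems" "x * y \<in> UpDown (e * f)"
    using idems_closed UpDown_mult by (auto simp: subsemigroup_def)
  then show "x * y \<in> UpDownE" by (auto simp: UpDownE_def)
qed

lemma pi_UpDown_mult:
  fixes x y :: 'a
  assumes "x \<in> UpDownE" "y \<in> UpDownE"
  shows "pi_UpDown (x * y) = pi_UpDown x * pi_UpDown y"
  using UpDownE_pi_UpDown[OF assms(1)] UpDownE_pi_UpDown[OF assms(2)] idems_closed
  by (intro pi_UpDown_eqI UpDown_mult) (auto simp: subsemigroup_def)

lemma hom_retraction_pi_UpDown: "hom_retraction pi_UpDown (UpDownE :: 'a set) idems"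
proof -
  have self: "e \<in> UpDown e" for e :: 'a by (simp add: UpDown_iff lesssim_refl)
  then have "(idems :: 'a set) \<subseteq> UpDownE" by (auto simp: UpDownE_def)
  with self show ?thesis
    using subsemigroup_UpDownE pi_UpDown_mult UpDownE_pi_UpDown pi_UpDown_eqI
    by (auto simp: hom_retraction_def)
qed

lemma hbar_UpDown_in_clifford_part:
  fixes x :: 'a
  assumes "x \<in> UpDownE"
  shows "hbar_UpDown x \<in> clifford_part"
proof -
  note e = UpDownE_pi_UpDown[OF assms]
  have x: "x \<in> Up (pi_UpDown x)" using e(2) by (simp add: UpDown_iff Up_def)
  show ?thesis
    using Up_mult_in_H_class[OF e(1) x] Up_commute[OF e(1) x] e(1)
    by (auto simp: hbar_UpDown_def clifford_part_def)
qed

text \<open>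
  The idempotent \<open>e = pi_UpDown x\<close> has to move past \<open>y\<close>, with which it need not commute. But next
  to \<open>e\<close> stands \<open>f = pi_UpDown y\<close>, and \<open>e * f\<close> does commute with
  \<open>y \<in> Up f \<subseteq> Up (e * f)\<close>.
\<close>

lemma hbar_UpDown_mult:
  fixes x y :: 'a
  assumes x: "x \<in> UpDownE" and y: "y \<in> UpDownE"
  shows "hbar_UpDown (x * y) = hbar_UpDown x * hbar_UpDown y"
proof -
  define e f where "e = pi_UpDown x" and "f = pi_UpDown y"
  have e: "e \<in> idems"
    using UpDownE_pi_UpDown[OF x] by (simp add: e_def)
  have f: "f \<in> idems" "f \<lesssim> y"
    using UpDownE_pi_UpDown[OF y] by (simp_all add: f_def UpDown_iff)
  have ef: "e * f \<in> idems" using idems_closed e f by (simp add: subsemigroup_def)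
  have "y \<in> Up (e * f)" using lesssim_trans[OF mult_lesssim_right f(2)] by (simp add: Up_def)
  then have "(e * f) * y = y * (e * f)" by (rule Up_commute[OF ef])
  then have "(x * y) * (e * f) = x * (e * (f * y))" by (simp add: mult.assoc)
  also have "f * y = y * f" using Up_commute[OF f(1)] f(2) by (simp add: Up_def)
  finally have "(x * y) * (e * f) = (x * e) * (y * f)" by (simp add: mult.assoc)
  then show ?thesis
    by (simp add: hbar_UpDown_def pi_UpDown_mult[OF x y] e_def f_def)
qed

lemma hom_retraction_hbar_UpDown:
  "hom_retraction hbar_UpDown (UpDownE :: 'a set) clifford_part"
proof -
  have "hbar_UpDown t = t" if "t \<in> clifford_part" for t :: 'a
    using that pi_UpDown_H_class H_class_fixed(2)
    by (auto simp: clifford_part_def hbar_UpDown_def)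
  then show ?thesis
    using subsemigroup_UpDownE clifford_part_subset_UpDownE hbar_UpDown_in_clifford_part
      hbar_UpDown_mult
    by (auto simp: hom_retraction_def)
qed

end

end

text \<open>The image of a homomorphism is closed under products.\<close>

lemma hom_retraction_subsemigroup:
  assumes "hom_retraction r S T"
  shows "subsemigroup T"
  unfolding subsemigroup_def
proof (intro ballI)
  fix x y assume "x \<in> T" "y \<in> T"
  then have S: "x \<in> S" "y \<in> S" and "r x = x" "r y = y"
    using assms by (auto simp: hom_retraction_def)
  then have "x * y = r (x * y)" using assms by (simp add: hom_retraction_def)
  moreover have "x * y \<in> S" using assms S by (simp add: hom_retraction_def subsemigroup_def)
  ultimately show "x * y \<in> T" using assms by (metis hom_retraction_def)
qed

theorem theorem4p2:
  assumes "E_semigroup TYPE('a::semigroup_mult)"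
    and "E_separated TYPE('a) TYPE('b)"
  shows "semilattice_on (idems :: 'a set) (*)
    \<and> (\<forall>e\<in>(idems :: 'a set). semigroup_ideal (H_class e) (Up e))
    \<and> (\<forall>e\<in>(idems :: 'a set). \<forall>x\<in>Up e. e * x = x * e \<and> e * x \<in> H_class e)
    \<and> (\<forall>x\<in>(idems :: 'a set). \<forall>y\<in>idems. x \<lesssim> y \<longleftrightarrow> nat_le x y)
    \<and> ((\<forall>x\<in>(UpDownE :: 'a set). \<exists>!e. e \<in> idems \<and> e \<in> UpDown x)
       \<and> hom_retraction pi_UpDown (UpDownE :: 'a set) idems)
    \<and> hom_retraction hbar_UpDown (UpDownE :: 'a set) clifford_part
    \<and> subsemigroup (clifford_part :: 'a set)"
proof -
  note swap = E_separated_swap[OF assms(2)]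
  have idems_closed: "subsemigroup (idems :: 'a set)"
    using assms(1) by (simp add: E_semigroup_def)
  have "\<exists>!e. e \<in> idems \<and> e \<in> UpDown x" if "x \<in> UpDownE" for x :: 'a
    using UpDownE_pi_UpDown[OF swap that] UpDown_idem_unique[OF swap, of _ x] by blast
  moreover have hbar: "hom_retraction hbar_UpDown (UpDownE :: 'a set) clifford_part"
    by (rule hom_retraction_hbar_UpDown[OF swap idems_closed])
  ultimately show ?thesis
    using semilattice_idems[OF swap idems_closed] H_class_ideal[OF swap]
      Up_commute[OF swap] Up_mult_in_H_class[OF swap] lesssim_idems_iff_nat_le[OF swap]
      hom_retraction_pi_UpDown[OF swap idems_closed] hom_retraction_subsemigroup[OF hbar]
    by blast
qed

end
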